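(* For every integer $k\geq 2$, there exists an integer $g(k)$ such that $rc_k(K_{r,r})=3$ for every integer $r\geq g(k)$.
   Context: All graphs are simple, finite and undirected. $K_{r,r}$ denotes the complete bipartite graph with both parts of size $r$. Given an edge-coloring of a graph $G$ (adjacent edges may receive the same color), a path is called rainbow if no two of its edges have the same color. For a $\kappa$-connected graph $G$ and an integer $k$ with $1\leq k\leq \kappa$, the rainbow $k$-connectivity $rc_k(G)$ is the minimum integer $j$ for which there exists an edge-coloring of $G$ with $j$ colors such that any two distinct vertices $u,v$ of $G$ are connected by at least $k$ internally disjoint rainbow $u$–$v$ paths. *)

theory Defs
  imports "Graph_Theory.Graph_Theory" "HOL-Library.Extended_Nat"
begin

text \<open>
  A finite simple undirected graph is a symmetric, loop-free, finite digraph without parallel arcs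
  (locale \<^locale>\<open>graph\<close>). The arcs \<open>(u,v)\<close> and \<open>(v,u)\<close> make up the single
  undirected edge \<open>{u,v}\<close>; it is these edges that are coloured. As there are no parallel
  arcs, a path is determined by its list of vertices.
\<close>

definition edges :: "('a,'b) pre_digraph \<Rightarrow> 'a set set" where
  "edges G = {{u, v} | u v. (u, v) \<in> arcs_ends G}"

definition edge_coloring :: "('a,'b) pre_digraph \<Rightarrow> nat \<Rightarrow> ('a set \<Rightarrow> nat) \<Rightarrow> bool" where
  "edge_coloring G j c \<longleftrightarrow> (\<forall>e \<in> edges G. c e \<in> {1..j})"

definition path_edges :: "'a list \<Rightarrow> 'a set list" where
  "path_edges p = map (\<lambda>(u, v). {u, v}) (vwalk_arcs p)"

definition path_between :: "('a,'b) pre_digraph \<Rightarrow> 'a \<Rightarrow> 'a list \<Rightarrow> 'a \<Rightarrow> bool" where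
  "path_between G u p v \<longleftrightarrow> vpath p G \<and> hd p = u \<and> last p = v"

definition rainbow :: "('a set \<Rightarrow> nat) \<Rightarrow> 'a list \<Rightarrow> bool" where
  "rainbow c p \<longleftrightarrow> distinct (map c (path_edges p))"

definition internally_disjoint :: "'a \<Rightarrow> 'a \<Rightarrow> 'a list set \<Rightarrow> bool" where
  "internally_disjoint u v P \<longleftrightarrow>
     (\<forall>p \<in> P. \<forall>q \<in> P. p \<noteq> q \<longrightarrow> (set p - {u, v}) \<inter> (set q - {u, v}) = {})"

definition rainbow_k_connected ::
  "('a,'b) pre_digraph \<Rightarrow> ('a set \<Rightarrow> nat) \<Rightarrow> nat \<Rightarrow> bool" where
  "rainbow_k_connected G c k \<longleftrightarrow>
     (\<forall>u \<in> verts G. \<forall>v \<in> verts G. u \<noteq> v \<longrightarrow>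
        (\<exists>P. finite P \<and> k \<le> card P \<and> internally_disjoint u v P \<and>
             (\<forall>p \<in> P. path_between G u p v \<and> rainbow c p)))"

text \<open>
  The value is \<open>\<infinity>\<close> if no edge-colouring works, i.e. if some two distinct vertices are not
  joined by \<open>k\<close> internally disjoint paths; otherwise the infimum is a minimum.
\<close>

definition rc :: "nat \<Rightarrow> ('a,'b) pre_digraph \<Rightarrow> enat" where
  "rc k G = (INF j \<in> {j. \<exists>c. edge_coloring G j c \<and> rainbow_k_connected G c k}. enat j)"

text \<open>Complete bipartite graphs of all sizes exist over the vertex type \<^typ>\<open>nat\<close>.\<close>

lemma complete_bipartite_nat_exists:
  "\<exists>G :: (nat, nat \<times> nat) pre_digraph. K\<^bsub>m,n\<^esub> G"
proof -
  define U V where "U = {..<m}" and "V = {m..<m+n}"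
  have "finite (U \<union> V)" "U \<inter> V = {}" "card U = m" "card V = n"
    by (auto simp: U_def V_def)
  then have "K\<^bsub>m,n\<^esub> (with_proj \<lparr>pverts = U \<union> V, parcs = U \<times> V \<union> V \<times> U\<rparr>)"
    unfolding complete_bipartite_digraph_pair_def pair_pre_digraph.simps by blast
  then show ?thesis by blast
qed

end

theory Submission
  imports Defs "HOL-Number_Theory.Cong"
begin

text \<open>
  Identify both parts of \<open>K\<^bsub>r,r\<^esub>\<close> with the residues modulo \<open>r\<close> and let the colour of an edge
  depend only on the difference of its ends. Differences that are powers \<open>3\<^sup>t\<close> with \<open>t < n\<close> get
  colour 1 or 2, according to whether 3 divides \<open>t\<close>; all other differences get colour 3. As
  these powers form a Sidon set modulo \<open>r\<close>, a nonzero residue is a difference of two of them in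
  at most one way. Hence if two vertices of the same part have a common neighbour at difference \<open>3\<^sup>t\<close>
  from the first one, then, except for at most one \<open>t\<close>, the edge to the second one has colour 3.
  Vertices of different parts are joined by the paths of length three whose first step is
  \<open>3\<^bsup>3t\<^esup>\<close>, whose last step is \<open>3\<^bsup>3t+1\<^esup>\<close> or \<open>3\<^bsup>3t+2\<^esup>\<close>, and whose middle edge has colour 3: at least one
  of the two choices works, except for at most one \<open>t\<close>.
  Conversely, of two paths joining adjacent vertices one has at least three edges.
\<close>

section \<open>Powers of 3 form a Sidon set\<close>

lemma power3_sum_eq_aux:
  fixes a b c d :: nat
  assumes "a \<le> b" "c \<le> d" "3 ^ a + 3 ^ b = (3 ^ c + 3 ^ d :: int)"
  shows "b \<le> d"
proof (rule ccontr)
  assume "\<not> b \<le> d"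
  \<comment> \<open>With \<open>b > d\<close>, the power \<open>3 ^ b\<close> is at least three
    times the larger term on the right, so it alone exceeds the right-hand sum.\<close>
  then have "(3::int) ^ Suc d \<le> 3 ^ b"
    by (intro power_increasing) auto
  moreover have "(3::int) ^ c \<le> 3 ^ d"
    using assms by (intro power_increasing) auto
  moreover have "(3::int) ^ a > 0" "(3::int) ^ d > 0"
    by simp_all
  ultimately show False
    using assms(3) unfolding power_Suc by linarith
qed

lemma power3_sum_eq:
  fixes a b c d :: nat
  assumes "3 ^ a + 3 ^ b = (3 ^ c + 3 ^ d :: int)"
  shows "a = c \<and> b = d \<or> a = d \<and> b = c"
proof -
  have *: "a = c \<and> b = d"
    if "a \<le> b" "c \<le> d" "3 ^ a + 3 ^ b = (3 ^ c + 3 ^ d :: int)" for a b c d :: nat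
  proof -
    have "b = d"
      using power3_sum_eq_aux[OF that] power3_sum_eq_aux[OF that(2,1)] that(3) by simp
    then show ?thesis
      using that(3) by simp
  qed
  show ?thesis
    using *[of a b c d] *[of b a c d] *[of a b d c] *[of b a d c] assms
    by (metis add.commute linorder_le_cases)
qed

section \<open>Colours of residues and counts of usable exponents\<close>

locale power_coloring =
  fixes n :: nat and m :: int
  assumes modulus: "2 * 3 ^ n \<le> m"
begin

lemma power_less: "t < n \<Longrightarrow> 2 * 3 ^ t < m"
  using modulus power_strict_increasing[of t n "3::int"] by linarith

text \<open>Each power involved is less than half the modulus, so both sums lie in the range where
  congruence means equality.\<close>

lemma powers_sidon:
  assumes "a < n" "b < n" "c < n" "d < n" "[3 ^ a + 3 ^ b = 3 ^ c + 3 ^ d] (mod m)"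
  shows "a = c \<and> b = d \<or> a = d \<and> b = c"
proof -
  have "(3::int) ^ a + 3 ^ b = 3 ^ c + 3 ^ d"
    using assms power_less[of a] power_less[of b] power_less[of c] power_less[of d]
    by (intro cong_less_imp_eq_int[of _ m]) simp_all
  then show ?thesis
    by (rule power3_sum_eq)
qed

lemma powers_inj:
  assumes "a < n" "b < n" "[3 ^ a = 3 ^ b] (mod m)"
  shows "a = b"
  using powers_sidon[of a a b b] assms cong_add[OF assms(3) assms(3)] by auto

text \<open>Each block \<open>3 * t\<close>, \<open>3 * t + 1\<close>, \<open>3 * t + 2\<close> of
  exponents below \<open>n\<close> offers one step of colour 1 and two alternative steps of colour
  2.\<close>

definition color :: "int \<Rightarrow> nat" where
  "color x = (if \<exists>t<n. 3 dvd t \<and> [x = 3 ^ t] (mod m) then 1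
              else if \<exists>t<n. [x = 3 ^ t] (mod m) then 2 else 3)"

lemma color_range: "color x \<in> {1..3}"
  by (simp add: color_def)

lemma color_cong: "[x = y] (mod m) \<Longrightarrow> color x = color y"
  unfolding color_def cong_def by presburger

lemma color_power: "t < n \<Longrightarrow> color (3 ^ t) = (if 3 dvd t then 1 else 2)"
  unfolding color_def using powers_inj by (auto simp: cong_refl)

lemma color_eq_3_iff: "color x = 3 \<longleftrightarrow> \<not> (\<exists>t<n. [x = 3 ^ t] (mod m))"
  by (auto simp: color_def)

text \<open>Here \<open>e\<close> is the difference of the labels of two vertices in one part. Two
  exceptional exponents would write \<open>e\<close> in two ways as a difference of powers.\<close>

lemma card_color_power_shift:
  assumes "\<not> [e = 0] (mod m)"
  shows "n - 1 \<le> card {t. t < n \<and> color (3 ^ t) \<noteq> color (3 ^ t + e)}"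
proof -
  define B where "B = {t. t < n \<and> color (3 ^ t + e) \<noteq> 3}"
  have "s = t" if "s \<in> B" "t \<in> B" for s t
  proof -
    from that obtain s' t' where st: "s < n" "t < n" "s' < n" "t' < n"
      "[3 ^ s + e = 3 ^ s'] (mod m)" "[3 ^ t' = 3 ^ t + e] (mod m)"
      unfolding B_def color_eq_3_iff by (auto simp: cong_sym_eq)
    have "[(3 ^ s + e) + 3 ^ t' = 3 ^ s' + (3 ^ t + e)] (mod m)"
      using st by (intro cong_add)
    then have "[3 ^ s + 3 ^ t' = 3 ^ s' + 3 ^ t] (mod m)"
      by (simp add: cong_iff_dvd_diff algebra_simps)
    then consider "s = s'" | "s = t"
      using powers_sidon st by blast
    then show ?thesis
    proof cases
      case 1
      then have "[e = 0] (mod m)"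
        using st(5) by (simp add: cong_iff_dvd_diff)
      then show ?thesis using assms by blast
    qed
  qed
  moreover have "finite B"
    by (simp add: B_def)
  ultimately have "card B \<le> 1"
    by (metis card_le_Suc0_iff_eq One_nat_def)
  moreover have "card {..<n} - card B \<le> card ({..<n} - B)"
    using \<open>finite B\<close> by (rule diff_card_le_card_Diff)
  moreover have "card ({..<n} - B) \<le> card {t. t < n \<and> color (3 ^ t) \<noteq> color (3 ^ t + e)}"
    by (rule card_mono) (auto simp: B_def color_power split: if_splits)
  ultimately show ?thesis by simp
qed

text \<open>With \<open>d\<close> the difference between the end vertices, the arguments of
  \<open>color\<close> are the differences of the two possible middle edges. If both failed,
  eliminating \<open>d\<close> would give a relation between four powers that forces
  \<open>a = a'\<close>, and then \<open>3 ^ s\<close> is congruent to \<open>d\<close>.\<close>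

lemma ex_power_color_3:
  assumes "s < n" "a < n" "b < n" "a \<noteq> b" "\<not> [3 ^ s = d] (mod m)"
  shows "color (3 ^ s + 3 ^ a - d) = 3 \<or> color (3 ^ s + 3 ^ b - d) = 3"
proof (rule ccontr)
  assume "\<not> ?thesis"
  then obtain a' b' where ab: "a' < n" "b' < n"
      "[3 ^ s + 3 ^ a - d = 3 ^ a'] (mod m)" "[3 ^ b' = 3 ^ s + 3 ^ b - d] (mod m)"
    unfolding color_eq_3_iff by (auto simp: cong_sym_eq)
  have "[(3 ^ s + 3 ^ a - d) + 3 ^ b' = 3 ^ a' + (3 ^ s + 3 ^ b - d)] (mod m)"
    using ab by (intro cong_add)
  then have "[3 ^ a + 3 ^ b' = 3 ^ a' + 3 ^ b] (mod m)"
    by (simp add: cong_iff_dvd_diff algebra_simps)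
  then have "a = a'"
    using powers_sidon assms ab by blast
  then show False
    using ab(3) assms(5) by (simp add: cong_iff_dvd_diff)
qed

text \<open>Among the \<open>k + 1\<close> values \<open>t \<le> k\<close>, at most one has its
  first step congruent to \<open>d\<close>; the largest exponent that may occur is
  \<open>3 * k + 2\<close>.\<close>

lemma ex_rainbow_steps:
  assumes "3 * k + 3 \<le> n"
  shows "\<exists>T z. finite T \<and> k \<le> card T \<and> inj_on z T \<and>
    (\<forall>t\<in>T. 3 * t < n \<and> z t < n \<and> color (3 ^ (3 * t)) = 1 \<and> color (3 ^ z t) = 2 \<and>
           color (3 ^ (3 * t) + 3 ^ z t - d) = 3)"
proof -
  define B where "B = {t. t \<le> k \<and> [3 ^ (3 * t) = d] (mod m)}"
  define z where "z t = (if color (3 ^ (3 * t) + 3 ^ (3 * t + 1) - d) = 3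
                         then 3 * t + 1 else 3 * t + 2)" for t
  have "s = t" if "s \<in> B" "t \<in> B" for s t
  proof -
    have "[3 ^ (3 * s) = 3 ^ (3 * t)] (mod m)" "3 * s < n" "3 * t < n"
      using that assms by (auto simp: B_def cong_def)
    then show ?thesis using powers_inj by fastforce
  qed
  moreover have "finite B"
    by (simp add: B_def)
  ultimately have "card B \<le> 1"
    by (metis card_le_Suc0_iff_eq One_nat_def)
  moreover have "card {..k} - card B \<le> card ({..k} - B)"
    using \<open>finite B\<close> by (rule diff_card_le_card_Diff)
  ultimately have "k \<le> card ({..k} - B)" by simp
  moreover have "3 * t < n \<and> z t < n \<and> color (3 ^ (3 * t)) = 1 \<and> color (3 ^ z t) = 2 \<and>
           color (3 ^ (3 * t) + 3 ^ z t - d) = 3" if "t \<in> {..k} - B" for t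
  proof -
    have t: "3 * t < n" "3 * t + 1 < n" "3 * t + 2 < n" "\<not> [3 ^ (3 * t) = d] (mod m)"
      using that assms by (auto simp: B_def)
    have "\<not> 3 dvd 3 * t + 1" "\<not> 3 dvd 3 * t + 2"
      by presburger+
    then show ?thesis
      using t ex_power_color_3[OF t(1,2,3) _ t(4)] by (auto simp: z_def color_power)
  qed
  \<comment> \<open>Dividing \<open>z t\<close> by 3 gives back \<open>t\<close>.\<close>
  moreover have "inj_on z ({..k} - B)"
    by (rule inj_onI) (simp add: z_def split: if_splits; presburger)
  ultimately show ?thesis
    by (intro exI[of _ "{..k} - B"] exI[of _ z]) simp
qed

end

section \<open>Families of internally disjoint short paths\<close>

definition rainbow_joined ::
  "('a,'b) pre_digraph \<Rightarrow> ('a set \<Rightarrow> nat) \<Rightarrow> nat \<Rightarrow> 'a \<Rightarrow> 'a \<Rightarrow> bool" where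
  "rainbow_joined G c k u v \<longleftrightarrow> (\<exists>P. finite P \<and> k \<le> card P \<and> internally_disjoint u v P \<and>
     (\<forall>p \<in> P. path_between G u p v \<and> rainbow c p))"

lemma (in wf_digraph) rainbow_joined2I:
  assumes "finite W" "k \<le> card W" "u \<noteq> v"
    and "\<And>w. w \<in> W \<Longrightarrow> w \<noteq> u \<and> w \<noteq> v \<and> (u, w) \<in> arcs_ends G \<and> (w, v) \<in> arcs_ends G \<and>
           c {u, w} \<noteq> c {w, v}"
  shows "rainbow_joined G c k u v"
proof -
  have "inj_on (\<lambda>w. [u, w, v]) W"
    by (auto intro: inj_onI)
  then have "card ((\<lambda>w. [u, w, v]) ` W) = card W"
    by (rule card_image)
  moreover have "path_between G u [u, w, v] v \<and> rainbow c [u, w, v]" if "w \<in> W" for w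
    using assms(3) assms(4)[OF that] adj_in_verts
    by (auto simp: path_between_def rainbow_def path_edges_def vpath_def vwalk_def)
  ultimately show ?thesis
    unfolding rainbow_joined_def internally_disjoint_def using assms(1,2)
    by (intro exI[of _ "(\<lambda>w. [u, w, v]) ` W"]) auto
qed

lemma (in wf_digraph) rainbow_joined3I:
  assumes "finite T" "k \<le> card T" "inj_on x T" "inj_on y T" "u \<noteq> v"
    and "\<And>s t. s \<in> T \<Longrightarrow> t \<in> T \<Longrightarrow> x s \<noteq> y t"
    and "\<And>t. t \<in> T \<Longrightarrow> x t \<notin> {u, v} \<and> y t \<notin> {u, v} \<and> (u, x t) \<in> arcs_ends G \<and>
           (x t, y t) \<in> arcs_ends G \<and> (y t, v) \<in> arcs_ends G \<and>
           distinct [c {u, x t}, c {x t, y t}, c {y t, v}]"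
  shows "rainbow_joined G c k u v"
proof -
  let ?p = "\<lambda>t. [u, x t, y t, v]"
  have "inj_on ?p T"
    using assms(3) by (auto simp: inj_on_def)
  then have "card (?p ` T) = card T"
    by (rule card_image)
  moreover have "path_between G u (?p t) v \<and> rainbow c (?p t)" if "t \<in> T" for t
    using assms(5) assms(6)[OF that that] assms(7)[OF that] adj_in_verts
    by (auto simp: path_between_def rainbow_def path_edges_def vpath_def vwalk_def)
  moreover have "internally_disjoint u v (?p ` T)"
    unfolding internally_disjoint_def
    using inj_onD[OF assms(3)] inj_onD[OF assms(4)] assms(6) by fastforce
  ultimately show ?thesis
    unfolding rainbow_joined_def using assms(1,2)
    by (intro exI[of _ "?p ` T"]) auto
qed

section \<open>Three colours suffice\<close>

text \<open>Making \<open>g\<close> total on the integers lets a vertex be addressed by any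
  representative of its residue.\<close>

lemma ex_residue_labelling:
  assumes "card U = r" "r > 0"
  shows "\<exists>(f :: 'a \<Rightarrow> int) g. inj_on f U \<and> f ` U = {0..<int r} \<and>
           (\<forall>x. g x \<in> U \<and> f (g x) = x mod int r)"
proof -
  have "finite U"
    using assms card_ge_0_finite by auto
  then obtain f where f: "bij_betw f U {0..<int r}"
    using assms finite_same_card_bij[of U "{0..<int r}"] by auto
  have "x mod int r \<in> f ` U" for x
    using f assms(2) by (simp add: bij_betw_def)
  then have "inv_into U f (x mod int r) \<in> U \<and> f (inv_into U f (x mod int r)) = x mod int r" for x
    by (simp add: inv_into_into f_inv_into_f)
  then show ?thesis
    using f by (intro exI[of _ f] exI[of _ "\<lambda>x. inv_into U f (x mod int r)"])
      (auto simp: bij_betw_def)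
qed

lemma complete_bipartite_rainbow_coloring:
  assumes G: "K\<^bsub>r,r\<^esub> G" and r: "2 * 3 ^ (3 * k + 3) \<le> r"
  shows "\<exists>c. edge_coloring G 3 c \<and> rainbow_k_connected G c k"
proof -
  define n where "n = 3 * k + 3"
  interpret graph G
    using G by (simp add: complete_bipartite_digraph_def)
  interpret power_coloring n "int r"
  proof
    have "int (2 * 3 ^ n) \<le> int r"
      using r unfolding n_def by (rule zle_int[THEN iffD2])
    then show "2 * 3 ^ n \<le> int r" by simp
  qed
  obtain U V where UV: "verts G = U \<union> V" "U \<inter> V = {}" "card U = r" "card V = r"
      "arcs_ends G = U \<times> V \<union> V \<times> U"
    using G by (auto simp: complete_bipartite_digraph_def)
  have "(0::nat) < 2 * 3 ^ (3 * k + 3)" by simp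
  then have "r > 0" using r by linarith
  obtain f f' where f: "inj_on f U" "f ` U = {0..<int r}"
      "\<And>x. f' x \<in> U" "\<And>x. f (f' x) = x mod int r"
    using ex_residue_labelling[OF UV(3) \<open>r > 0\<close>] by blast
  obtain h h' where h: "inj_on h V" "h ` V = {0..<int r}"
      "\<And>x. h' x \<in> V" "\<And>x. h (h' x) = x mod int r"
    using ex_residue_labelling[OF UV(4) \<open>r > 0\<close>] by blast
  have f'_eq: "[x = y] (mod int r)" if "f' x = f' y" for x y
    using f(4)[of x] f(4)[of y] that by (simp add: cong_def)
  have h'_eq: "[x = y] (mod int r)" if "h' x = h' y" for x y
    using h(4)[of x] h(4)[of y] that by (simp add: cong_def)
  have f_cong: "u = u'" if "u \<in> U" "u' \<in> U" "[f u = f u'] (mod int r)" for u u'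
  proof -
    have "f u \<in> {0..<int r}" "f u' \<in> {0..<int r}" using that f(2) by blast+
    then have "f u = f u'" using that(3) by (simp add: cong_def)
    then show ?thesis using f(1) that by (simp add: inj_on_def)
  qed
  have h_cong: "u = u'" if "u \<in> V" "u' \<in> V" "[h u = h u'] (mod int r)" for u u'
  proof -
    have "h u \<in> {0..<int r}" "h u' \<in> {0..<int r}" using that h(2) by blast+
    then have "h u = h u'" using that(3) by (simp add: cong_def)
    then show ?thesis using h(1) that by (simp add: inj_on_def)
  qed
  \<comment> \<open>An edge is an unordered set, so its difference is always taken from the end in
    \<open>U\<close> to the end in \<open>V\<close>. Sets that are not edges also get a value in
    \<open>{1..3}\<close>.\<close>
  define c where "c e = color (h (THE v. v \<in> e \<inter> V) - f (THE u. u \<in> e \<inter> U))" for e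
  have c: "c {u, v} = color (h v - f u)" if "u \<in> U" "v \<in> V" for u v
  proof -
    have "{u, v} \<inter> V = {v}" "{u, v} \<inter> U = {u}"
      using that UV(2) by auto
    then show ?thesis by (simp add: c_def)
  qed
  \<comment> \<open>The neighbour of \<open>u\<close> at difference \<open>x\<close> is
    \<open>h' (f u + x)\<close>; that of \<open>v\<close> is \<open>f' (h v - x)\<close>.\<close>
  have c_from_U: "c {u, h' (f u + x)} = color x" if "u \<in> U" for u x
    using that h(3) by (auto simp: c h(4) cong_def mod_simps intro!: color_cong)
  have c_from_V: "c {f' (h v - x), v} = color x" if "v \<in> V" for v x
    using that f(3) by (auto simp: c f(4) cong_def mod_simps intro!: color_cong)
  have disjoint: "v \<in> V \<Longrightarrow> f' x \<noteq> v" "u \<in> U \<Longrightarrow> h' x \<noteq> u" for u v x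
    using f(3) h(3) UV(2) by blast+
  have same_U: "rainbow_joined G c k u u'" if u: "u \<in> U" "u' \<in> U" "u \<noteq> u'" for u u'
  proof -
    define e where "e = f u - f u'"
    define T where "T = {t. t < n \<and> color (3 ^ t) \<noteq> color (3 ^ t + e)}"
    have e: "\<not> [e = 0] (mod int r)"
      using f_cong[OF u(1,2)] u(3) by (auto simp: e_def cong_diff_iff_cong_0)
    have inj: "inj_on (\<lambda>t. h' (f u + 3 ^ t)) T"
      by (auto simp: T_def intro!: inj_onI powers_inj dest!: h'_eq cong_add_lcancel[THEN iffD1])
    have "k \<le> card T"
      using card_color_power_shift[OF e] by (simp add: T_def n_def)
    then have "k \<le> card ((\<lambda>t. h' (f u + 3 ^ t)) ` T)"
      by (simp add: card_image[OF inj])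
    moreover have "c {h' (f u + x), u'} = color (x + e)" for x
      using c_from_U[OF u(2), of "x + e"]
      by (simp add: e_def algebra_simps insert_commute)
    ultimately show ?thesis
      using u UV(2) h(3) disjoint
      by (intro rainbow_joined2I[where W = "(\<lambda>t. h' (f u + 3 ^ t)) ` T"])
        (auto simp: T_def UV(5) c_from_U)
  qed
  have same_V: "rainbow_joined G c k v v'" if v: "v \<in> V" "v' \<in> V" "v \<noteq> v'" for v v'
  proof -
    \<comment> \<open>The sign is opposite to the case of \<open>U\<close>, since a common neighbour
      now lies at the start of each difference.\<close>
    define e where "e = h v' - h v"
    define T where "T = {t. t < n \<and> color (3 ^ t) \<noteq> color (3 ^ t + e)}"
    have e: "\<not> [e = 0] (mod int r)"
      using h_cong[OF v(2,1)] v(3) by (auto simp: e_def cong_diff_iff_cong_0)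
    have inj: "inj_on (\<lambda>t. f' (h v - 3 ^ t)) T"
      by (auto simp: T_def cong_iff_dvd_diff dvd_diff_commute intro!: inj_onI powers_inj dest!: f'_eq)
    have "k \<le> card T"
      using card_color_power_shift[OF e] by (simp add: T_def n_def)
    then have "k \<le> card ((\<lambda>t. f' (h v - 3 ^ t)) ` T)"
      by (simp add: card_image[OF inj])
    moreover have "c {v, f' (h v - x)} = color x" for x
      using c_from_V[OF v(1), of x] by (simp add: insert_commute)
    moreover have "c {f' (h v - x), v'} = color (x + e)" for x
      using c_from_V[OF v(2), of "x + e"] by (simp add: e_def algebra_simps)
    ultimately show ?thesis
      using v UV(2) f(3) disjoint
      by (intro rainbow_joined2I[where W = "(\<lambda>t. f' (h v - 3 ^ t)) ` T"])
        (auto simp: T_def UV(5))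
  qed
  have diff: "rainbow_joined G c k u v \<and> rainbow_joined G c k v u"
    if uv: "u \<in> U" "v \<in> V" for u v
  proof -
    define d where "d = h v - f u"
    obtain T z where T: "finite T" "k \<le> card T" "inj_on z T"
      and step: "\<And>t. t \<in> T \<Longrightarrow> 3 * t < n \<and> z t < n \<and> color (3 ^ (3 * t)) = 1 \<and>
        color (3 ^ z t) = 2 \<and> color (3 ^ (3 * t) + 3 ^ z t - d) = 3"
      using ex_rainbow_steps[of k d] by (auto simp: n_def)
    \<comment> \<open>The path \<open>u\<close>, \<open>x t\<close>, \<open>y t\<close>,
      \<open>v\<close> gets the colours 1, 3, 2 in this order.\<close>
    define x where "x t = h' (f u + 3 ^ (3 * t))" for t
    define y where "y t = f' (h v - 3 ^ z t)" for t
    have xV: "x t \<in> V" and yU: "y t \<in> U" for t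
      using f(3) h(3) by (simp_all add: x_def y_def)
    have "inj_on x T"
    proof (rule inj_onI)
      fix s t assume st: "s \<in> T" "t \<in> T" "x s = x t"
      then have "[3 ^ (3 * s) = 3 ^ (3 * t)] (mod int r)"
        using h'_eq cong_add_lcancel unfolding x_def by blast
      moreover have "3 * s < n" "3 * t < n"
        using step st by blast+
      ultimately have "3 * s = 3 * t"
        using powers_inj by blast
      then show "s = t" by simp
    qed
    have "inj_on y T"
    proof (rule inj_onI)
      fix s t assume st: "s \<in> T" "t \<in> T" "y s = y t"
      then have "[h v - 3 ^ z s = h v - 3 ^ z t] (mod int r)"
        using f'_eq unfolding y_def by blast
      then have "[3 ^ z s = 3 ^ z t] (mod int r)"
        by (simp add: cong_iff_dvd_diff dvd_diff_commute)
      then show "s = t" using powers_inj step st T(3) by (meson inj_onD)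
    qed
    have col: "c {u, x t} = 1" "c {y t, v} = 2" "c {y t, x t} = 3" if "t \<in> T" for t
    proof -
      show "c {u, x t} = 1" "c {y t, v} = 2"
        using c_from_U[OF uv(1)] c_from_V[OF uv(2)] step[OF that] by (simp_all add: x_def y_def)
      have "[h (x t) - f (y t) = (f u + 3 ^ (3 * t)) - (h v - 3 ^ z t)] (mod int r)"
        by (intro cong_diff) (simp_all add: x_def y_def f(4) h(4) cong_def)
      then have "[h (x t) - f (y t) = 3 ^ (3 * t) + 3 ^ z t - d] (mod int r)"
        by (simp add: d_def algebra_simps)
      then show "c {y t, x t} = 3"
        using step[OF that] c[OF yU xV] color_cong by metis
    qed
    \<comment> \<open>If \<open>x t = v\<close>, one edge would have both colours 2 and 3; if
      \<open>y t = u\<close>, both 1 and 3.\<close>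
    have ne: "x t \<noteq> v" "y t \<noteq> u" if "t \<in> T" for t
      using col[OF that] by auto
    have cross: "x s \<noteq> y t" "y t \<noteq> x s" "x s \<noteq> u" "y t \<noteq> v" "u \<noteq> v" "v \<noteq> u" for s t
      using xV[of s] yU[of t] uv UV(2) by auto
    have "rainbow_joined G c k u v"
      using uv xV yU ne cross
      by (intro rainbow_joined3I[OF T(1,2) \<open>inj_on x T\<close> \<open>inj_on y T\<close>])
        (simp_all add: UV(5) col insert_commute[of "x _" "y _"])
    \<comment> \<open>These are the same paths traversed backwards, with \<open>x\<close> and
      \<open>y\<close> exchanged.\<close>
    moreover have "rainbow_joined G c k v u"
      using uv xV yU ne cross
      by (intro rainbow_joined3I[OF T(1,2) \<open>inj_on y T\<close> \<open>inj_on x T\<close>])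
        (simp_all add: UV(5) col insert_commute[of v] insert_commute[of "x _" u])
    ultimately show ?thesis ..
  qed
  have "rainbow_k_connected G c k"
    unfolding rainbow_k_connected_def rainbow_joined_def[symmetric] UV(1)
    using same_U same_V diff by blast
  moreover have "edge_coloring G 3 c"
    unfolding edge_coloring_def c_def using color_range by blast
  ultimately show ?thesis by blast
qed

section \<open>Two colours do not suffice\<close>

lemma complete_bipartite_rainbow_ge_3:
  assumes G: "K\<^bsub>r,r\<^esub> G" and "r > 0" "k \<ge> 2"
    and c: "edge_coloring G j c" "rainbow_k_connected G c k"
  shows "j \<ge> 3"
proof -
  obtain U V where UV: "verts G = U \<union> V" "U \<inter> V = {}" "card U = r" "card V = r"
      "arcs_ends G = U \<times> V \<union> V \<times> U"
    using G by (auto simp: complete_bipartite_digraph_def)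
  then obtain u v where uv: "u \<in> U" "v \<in> V"
    using \<open>r > 0\<close> by (metis card.empty equals0I less_numeral_extra(3))
  then obtain P where P: "finite P" "k \<le> card P"
      "\<And>p. p \<in> P \<Longrightarrow> path_between G u p v \<and> rainbow c p"
    using c(2) UV(1,2) unfolding rainbow_k_connected_def by (metis Un_iff disjoint_iff)
  \<comment> \<open>Since \<open>k \<ge> 2\<close>, a path other than the single edge must
    occur.\<close>
  have "\<not> P \<subseteq> {[u, v]}"
    using card_mono[of "{[u, v]}" P] P(2) \<open>k \<ge> 2\<close> by auto
  then obtain p where "p \<in> P" "p \<noteq> [u, v]" by blast
  then have p: "vpath p G" "hd p = u" "last p = v" "rainbow c p"
    using P(3) by (auto simp: path_between_def)
  have "length (path_edges p) \<ge> 3"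
  proof (rule ccontr)
    assume "\<not> ?thesis"
    then have "length p < 4"
      by (auto simp: path_edges_def vwalk_length_def[symmetric])
    then consider "p = []" | a where "p = [a]" | a b where "p = [a, b]"
        | a b d where "p = [a, b, d]"
      by (auto simp: less_Suc_eq numeral_eq_Suc length_Suc_conv)
    \<comment> \<open>The empty list is no path, one vertex would give \<open>u = v\<close>, two
      vertices give the excluded edge, and three would put \<open>u\<close> and \<open>v\<close> in
      the same part.\<close>
    then show False
      using p uv UV(2,5) \<open>p \<noteq> [u, v]\<close>
      by cases (auto simp: vpath_def vwalk_def)
  qed
  also have "length (path_edges p) = card (c ` set (path_edges p))"
    using p(4) unfolding rainbow_def by (metis distinct_card length_map list.set_map)
  also have "\<dots> \<le> card {1..j}"
  proof (rule card_mono)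
    have "set (path_edges p) \<subseteq> edges G"
      using p(1) by (auto simp: path_edges_def edges_def vpath_def vwalk_def)
    then show "c ` set (path_edges p) \<subseteq> {1..j}"
      using c(1) by (auto simp: edge_coloring_def)
  qed simp
  finally show ?thesis by simp
qed

theorem theorem2p4:
  fixes k :: nat
  assumes "k \<ge> 2"
  shows "\<exists>g :: nat. \<forall>r \<ge> g. \<forall>G :: ('a, 'b) pre_digraph. K\<^bsub>r,r\<^esub> G \<longrightarrow> rc k G = 3"
\<comment> \<open>The witness is the least modulus allowed in \<open>power_coloring\<close> for
  \<open>n = 3 * k + 3\<close>.\<close>
proof (intro exI[of _ "2 * 3 ^ (3 * k + 3)"] allI impI)
  fix r :: nat and G :: "('a, 'b) pre_digraph"
  assume r: "2 * 3 ^ (3 * k + 3) \<le> r" and G: "K\<^bsub>r,r\<^esub> G"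
  have "(0::nat) < 2 * 3 ^ (3 * k + 3)" by simp
  then have "r > 0" using r by linarith
  have "rc k G \<le> enat 3"
    unfolding rc_def using complete_bipartite_rainbow_coloring[OF G r] by (intro INF_lower) simp
  moreover have "enat 3 \<le> rc k G"
    unfolding rc_def
    using complete_bipartite_rainbow_ge_3[OF G \<open>r > 0\<close> assms] by (intro INF_greatest) auto
  ultimately show "rc k G = 3"
    by (simp add: numeral_eq_enat)
qed

end
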